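(* Let $T^*:[0,1]^2\to[0,1]$ be an associative monotone function with a neutral element in $[0,1]$. Let $f:[0,1]\to[0,1]$ be a non-constant non-decreasing right continuous function with $f(1)=1$, let $M=\mathrm{Ran}(f)$, and let $T:[0,1]^2\to[0,1]$ be defined by $T(x,y)=f^{(-1)}(T^*(f(x),f(y)))$. Then the function $T$ is associative if and only if $\mathfrak{T}(M)\cap M=\emptyset$.
   Context: The pseudo-inverse of a non-decreasing $f:[0,1]\to[0,1]$ is $f^{(-1)}(y)=\sup\{x\in[0,1]\mid f(x)<y\}$, with $\sup\emptyset=0$. "Monotone" for $T^*$ means non-decreasing in each variable, or non-increasing in each variable. $\mathcal{A}$ is the family of all sets $M\subseteq[0,1]$ for which there is a non-decreasing right continuous function $f:[0,1]\to[0,1]$ with $\mathrm{Ran}(f)=M$; then $f(1)=\max M$. Let $(\mathcal{S},\mathcal{C})=(\{[b_k,d_k]\mid k\in K\},\{c_k\mid k\in\overline{K}\})$ be associated with $M$, in the following sense. A pair $(\mathcal{S},\mathcal{C})$ is associated with $M\in\mathcal{A}$, $M\neq[0,f(1)]$, if: $\mathcal{S}=\{[b_k,d_k]\subseteq[0,1]\mid k\in K\}$ is a non-empty countable (possibly finite) system of closed intervals of positive length such that for any two distinct members $[b_k,d_k],[b_l,d_l]$ either $[b_k,d_k]\cap[b_l,d_l]=\emptyset$, or $[b_k,d_k]\cap[b_l,d_l]=\{d_k\}$ when $d_k\le b_l$; $\mathcal{C}=\{c_k\in[0,1]\mid k\in\overline{K}\}$ is a non-empty countable set such that for all $k\in K$,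 $[b_k,d_k]\cap\mathcal{C}=\{d_k\}$ or $[b_k,d_k]\cap\mathcal{C}=\{b_k,d_k\}$; and $M=\{c_k\mid k\in\overline{K}\}\cup\big([0,f(1)]\setminus\bigcup_{k\in K}[b_k,d_k]\big)$. If $M=[0,f(1)]$, the associated pair is $\mathcal{S}=\{[f(1),f(1)]\}$, $\mathcal{C}=\{f(1)\}$. For $A\subseteq[0,1]$, $O(A)=\bigcup_{x,y\in A}[\min\{x,y\},\max\{x,y\})$ (with $[x,x)=\emptyset$), and $O(\emptyset)=\emptyset$. For $A\subseteq[0,1]$ and $c\in[0,1]$, $T^*(A,c)=\{T^*(x,c)\mid x\in A\}$ and $T^*(c,A)=\{T^*(c,x)\mid x\in A\}$ (empty if $A$ is empty). For $y\in M$ and $k,l\in K$: $M_k^y=\{x\in M\mid T^*(x,y)\in(b_k,d_k)\text{ if } b_k\in M,\ T^*(x,y)\in[b_k,d_k)\text{ if } b_k\notin M\}$; $M_y^k=\{x\in M\mid T^*(y,x)\in(b_k,d_k)\text{ if } b_k\in M,\ T^*(y,x)\in[b_k,d_k)\text{ if } b_k\notin M\}$; $M^y=\{x\in M\mid T^*(x,y)\in M\}$; $M_y=\{x\in M\mid T^*(y,x)\in M\}$; $I_k^y=\{d_k\}\cup T^*(M_k^y,y)$; $I_y^k=\{d_k\}\cup T^*(y,M_y^k)$; $J_{k,l}^y=O\big(T^*(M_k^y,d_l)\cup T^*(d_k,M_y^l)\big)$ if $M_k^y\ne\emptyset$ and $M_y^l\neq\emptyset$, and $J_{k,l}^y=\emptyset$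 otherwise. $\mathfrak{T}_1(M)=\bigcup_{y\in M}\bigcup_{k\in K}\bigcup_{t\in M_y}O(T^*(I_k^y,t))$; $\mathfrak{T}_2(M)=\bigcup_{y\in M}\bigcup_{k\in K}\bigcup_{t\in M^y}O(T^*(t,I_y^k))$; $\mathfrak{T}_3(M)=\bigcup_{y\in M}\bigcup_{k,l\in K}J_{k,l}^y$; $\mathfrak{T}(M)=\mathfrak{T}_1(M)\cup\mathfrak{T}_2(M)\cup\mathfrak{T}_3(M)$. *)

theory Defs
  imports "HOL-Analysis.Analysis"
begin

text \<open>
  Functions on \<open>[0,1]\<close> and \<open>[0,1]\<^sup>2\<close> are total functions on the reals; every condition on them is
  relativised to \<open>{0..1}\<close>.
\<close>

definition pseudo_inverse :: "(real \<Rightarrow> real) \<Rightarrow> real \<Rightarrow> real" where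
  "pseudo_inverse f y =
     (let A = {x \<in> {0..1}. f x < y} in if A = {} then 0 else Sup A)"

definition right_continuous_unit :: "(real \<Rightarrow> real) \<Rightarrow> bool" where
  "right_continuous_unit f \<longleftrightarrow> (\<forall>x\<in>{0..<1}. continuous (at_right x) f)"

definition binop_unit :: "(real \<Rightarrow> real \<Rightarrow> real) \<Rightarrow> bool" where
  "binop_unit T \<longleftrightarrow> (\<forall>x\<in>{0..1}. \<forall>y\<in>{0..1}. T x y \<in> {0..1})"

definition associative_unit :: "(real \<Rightarrow> real \<Rightarrow> real) \<Rightarrow> bool" where
  "associative_unit T \<longleftrightarrow>
     (\<forall>x\<in>{0..1}. \<forall>y\<in>{0..1}. \<forall>z\<in>{0..1}. T (T x y) z = T x (T y z))"

definition monotone_unit :: "(real \<Rightarrow> real \<Rightarrow> real) \<Rightarrow> bool" where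
  "monotone_unit T \<longleftrightarrow>
     (\<forall>c\<in>{0..1}. mono_on {0..1} (\<lambda>x. T x c) \<and> mono_on {0..1} (\<lambda>x. T c x)) \<or>
     (\<forall>c\<in>{0..1}. antimono_on {0..1} (\<lambda>x. T x c) \<and> antimono_on {0..1} (\<lambda>x. T c x))"

definition neutral_unit :: "(real \<Rightarrow> real \<Rightarrow> real) \<Rightarrow> real \<Rightarrow> bool" where
  "neutral_unit T e \<longleftrightarrow> e \<in> {0..1} \<and> (\<forall>x\<in>{0..1}. T e x = x \<and> T x e = x)"

text \<open>The family \<open>\<A>\<close> of ranges. Its members have a maximum, \<open>f 1\<close>, written \<open>Sup M\<close> below.\<close>

definition range_family :: "real set set" where
  "range_family = {f ` {0..1} | f.
     f \<in> {0..1} \<rightarrow> {0..1} \<and> mono_on {0..1} f \<and> right_continuous_unit f}"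

text \<open>
  The pair \<open>(\<S>, \<C>)\<close> is associated with \<open>M\<close>. The system \<open>\<S>\<close> is given by its indexing
  \<open>k \<mapsto> [b k, d k]\<close>, \<open>k \<in> K\<close>, which may repeat members. Disjointness up to endpoints is a condition
  on unordered pairs of members, hence the two symmetric cases.
\<close>

definition associated ::
  "real set \<Rightarrow> 'k set \<Rightarrow> ('k \<Rightarrow> real) \<Rightarrow> ('k \<Rightarrow> real) \<Rightarrow> real set \<Rightarrow> bool" where
  "associated M K b d C \<longleftrightarrow> M \<in> range_family \<and>
     (let S = (\<lambda>k. {b k..d k}) ` K in
      if M = {0..Sup M} then S = {{Sup M..Sup M}} \<and> C = {Sup M}
      else
        S \<noteq> {} \<and> countable S \<and>
        (\<forall>k\<in>K. 0 \<le> b k \<and> b k < d k \<and> d k \<le> 1) \<and>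
        (\<forall>k\<in>K. \<forall>l\<in>K. {b k..d k} \<noteq> {b l..d l} \<longrightarrow>
            {b k..d k} \<inter> {b l..d l} = {} \<or>
            d k \<le> b l \<and> {b k..d k} \<inter> {b l..d l} = {d k} \<or>
            d l \<le> b k \<and> {b k..d k} \<inter> {b l..d l} = {d l}) \<and>
        C \<noteq> {} \<and> countable C \<and> C \<subseteq> {0..1} \<and>
        (\<forall>k\<in>K. {b k..d k} \<inter> C = {d k} \<or> {b k..d k} \<inter> C = {b k, d k}) \<and>
        M = C \<union> ({0..Sup M} - \<Union>S))"

definition O_set :: "real set \<Rightarrow> real set" where
  "O_set A = (\<Union>x\<in>A. \<Union>y\<in>A. {min x y..<max x y})"

text \<open>
  Below, \<open>Ts\<close> is \<open>T\<^sup>*\<close>, and in \<open>M_up\<close>, \<open>I_up\<close>, \<dots> (\<open>M_low\<close>, \<open>I_low\<close>, \<dots>) the element \<open>y\<close> is written as a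
  superscript (subscript) in the usual notation, i.e. it is the right (left) argument of \<open>T\<^sup>*\<close>.
\<close>

definition gap :: "real set \<Rightarrow> ('k \<Rightarrow> real) \<Rightarrow> ('k \<Rightarrow> real) \<Rightarrow> 'k \<Rightarrow> real set" where
  "gap M b d k = (if b k \<in> M then {b k<..<d k} else {b k..<d k})"

definition M_up_k ::
  "(real \<Rightarrow> real \<Rightarrow> real) \<Rightarrow> real set \<Rightarrow> ('k \<Rightarrow> real) \<Rightarrow> ('k \<Rightarrow> real) \<Rightarrow> 'k \<Rightarrow> real \<Rightarrow> real set" where
  "M_up_k Ts M b d k y = {x \<in> M. Ts x y \<in> gap M b d k}"

definition M_low_k ::
  "(real \<Rightarrow> real \<Rightarrow> real) \<Rightarrow> real set \<Rightarrow> ('k \<Rightarrow> real) \<Rightarrow> ('k \<Rightarrow> real) \<Rightarrow> 'k \<Rightarrow> real \<Rightarrow> real set" where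
  "M_low_k Ts M b d k y = {x \<in> M. Ts y x \<in> gap M b d k}"

definition M_up :: "(real \<Rightarrow> real \<Rightarrow> real) \<Rightarrow> real set \<Rightarrow> real \<Rightarrow> real set" where
  "M_up Ts M y = {x \<in> M. Ts x y \<in> M}"

definition M_low :: "(real \<Rightarrow> real \<Rightarrow> real) \<Rightarrow> real set \<Rightarrow> real \<Rightarrow> real set" where
  "M_low Ts M y = {x \<in> M. Ts y x \<in> M}"

definition I_up ::
  "(real \<Rightarrow> real \<Rightarrow> real) \<Rightarrow> real set \<Rightarrow> ('k \<Rightarrow> real) \<Rightarrow> ('k \<Rightarrow> real) \<Rightarrow> 'k \<Rightarrow> real \<Rightarrow> real set" where
  "I_up Ts M b d k y = {d k} \<union> (\<lambda>x. Ts x y) ` M_up_k Ts M b d k y"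

definition I_low ::
  "(real \<Rightarrow> real \<Rightarrow> real) \<Rightarrow> real set \<Rightarrow> ('k \<Rightarrow> real) \<Rightarrow> ('k \<Rightarrow> real) \<Rightarrow> 'k \<Rightarrow> real \<Rightarrow> real set" where
  "I_low Ts M b d k y = {d k} \<union> (\<lambda>x. Ts y x) ` M_low_k Ts M b d k y"

definition J_set ::
  "(real \<Rightarrow> real \<Rightarrow> real) \<Rightarrow> real set \<Rightarrow> ('k \<Rightarrow> real) \<Rightarrow> ('k \<Rightarrow> real) \<Rightarrow> 'k \<Rightarrow> 'k \<Rightarrow> real \<Rightarrow> real set" where
  "J_set Ts M b d k l y =
     (if M_up_k Ts M b d k y \<noteq> {} \<and> M_low_k Ts M b d l y \<noteq> {}
      then O_set ((\<lambda>x. Ts x (d l)) ` M_up_k Ts M b d k y \<union>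
                  (\<lambda>x. Ts (d k) x) ` M_low_k Ts M b d l y)
      else {})"

definition T1_set ::
  "(real \<Rightarrow> real \<Rightarrow> real) \<Rightarrow> real set \<Rightarrow> 'k set \<Rightarrow> ('k \<Rightarrow> real) \<Rightarrow> ('k \<Rightarrow> real) \<Rightarrow> real set" where
  "T1_set Ts M K b d =
     (\<Union>y\<in>M. \<Union>k\<in>K. \<Union>t\<in>M_low Ts M y. O_set ((\<lambda>x. Ts x t) ` I_up Ts M b d k y))"

definition T2_set ::
  "(real \<Rightarrow> real \<Rightarrow> real) \<Rightarrow> real set \<Rightarrow> 'k set \<Rightarrow> ('k \<Rightarrow> real) \<Rightarrow> ('k \<Rightarrow> real) \<Rightarrow> real set" where
  "T2_set Ts M K b d =
     (\<Union>y\<in>M. \<Union>k\<in>K. \<Union>t\<in>M_up Ts M y. O_set ((\<lambda>x. Ts t x) ` I_low Ts M b d k y))"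

definition T3_set ::
  "(real \<Rightarrow> real \<Rightarrow> real) \<Rightarrow> real set \<Rightarrow> 'k set \<Rightarrow> ('k \<Rightarrow> real) \<Rightarrow> ('k \<Rightarrow> real) \<Rightarrow> real set" where
  "T3_set Ts M K b d = (\<Union>y\<in>M. \<Union>k\<in>K. \<Union>l\<in>K. J_set Ts M b d k l y)"

definition T_set ::
  "(real \<Rightarrow> real \<Rightarrow> real) \<Rightarrow> real set \<Rightarrow> 'k set \<Rightarrow> ('k \<Rightarrow> real) \<Rightarrow> ('k \<Rightarrow> real) \<Rightarrow> real set" where
  "T_set Ts M K b d = T1_set Ts M K b d \<union> T2_set Ts M K b d \<union> T3_set Ts M K b d"

end

theory Submission
  imports Defs
begin

text \<open>
  Write \<open>g\<close> for the pseudo-inverse of \<open>f\<close>. Because \<open>f\<close> is right continuous and \<open>f 1 = 1\<close>, the two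
  form a Galois connection, \<open>g y \<le> x \<longleftrightarrow> y \<le> f x\<close> (\<open>pseudo_inverse_le_iff\<close>). It has two consequences.
  First, \<open>f (g u)\<close> is the least element of \<open>M = Ran f\<close> above \<open>u\<close>: it is \<open>u\<close> itself when \<open>u \<in> M\<close>, and
  the right end \<open>d\<^sub>k\<close> when \<open>u\<close> lies in the gap \<open>k\<close> of \<open>M\<close>. Second, \<open>g u = g v\<close> holds exactly when no
  point of \<open>M\<close> separates \<open>u\<close> from \<open>v\<close>, that is, when \<open>[min u v, max u v)\<close> misses \<open>M\<close>; hence
  \<open>O(A) \<inter> M = \<emptyset>\<close> says precisely that \<open>g\<close> is constant on \<open>A\<close>.

  After the substitution \<open>x \<mapsto> f x\<close>, associativity of \<open>T\<close> becomes the identity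
  \<open>g (T\<^sup>* (r (T\<^sup>* x y)) z) = g (T\<^sup>* x (r (T\<^sup>* y z)))\<close> for \<open>x, y, z \<in> M\<close>, where \<open>r u = f (g u)\<close> rounds \<open>u\<close>
  up into \<open>M\<close>. Split according to which of \<open>T\<^sup>* x y\<close> and \<open>T\<^sup>* y z\<close> lie in \<open>M\<close>. If both do, the
  identity is associativity of \<open>T\<^sup>*\<close>. If only \<open>T\<^sup>* y z\<close> does, it compares \<open>T\<^sup>* d\<^sub>k z\<close> with
  \<open>T\<^sup>* x (T\<^sup>* y z) = T\<^sup>* (T\<^sup>* x y) z\<close> and so says that \<open>g\<close> is constant on \<open>T\<^sup>*(I\<^sub>k\<^sup>y, z)\<close>: this is what
  \<open>\<TT>\<^sub>1\<close> measures. The mirror case belongs to \<open>\<TT>\<^sub>2\<close>. If neither does, it compares \<open>T\<^sup>* d\<^sub>k z\<close> with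
  \<open>T\<^sup>* x d\<^sub>l\<close>, which is constancy of \<open>g\<close> on the set defining \<open>J\<^sub>k\<^sub>l\<^sup>y\<close>, so it belongs to \<open>\<TT>\<^sub>3\<close>.
\<close>

section \<open>The pseudo-inverse as a lower adjoint\<close>

text \<open>
  The least upper bound of \<open>{x. f x < y}\<close> is also the greatest lower bound of \<open>{x. y \<le> f x}\<close>, and right
  continuity puts it into the latter set. The condition \<open>y \<le> f 1\<close> keeps that set non-empty.
\<close>

lemma pseudo_inverse_le_iff:
  fixes f :: "real \<Rightarrow> real"
  assumes mono: "mono_on {0..1} f" and rc: "right_continuous_unit f"
    and y: "y \<le> f 1" and x: "x \<in> {0..1}"
  shows "pseudo_inverse f y \<in> {0..1}"
    and "pseudo_inverse f y \<le> x \<longleftrightarrow> y \<le> f x"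
proof -
  define A where "A = {x \<in> {0..1}. f x < y}"
  define g where "g = pseudo_inverse f y"
  have g: "g = (if A = {} then 0 else Sup A)"
    unfolding g_def pseudo_inverse_def A_def Let_def ..
  have bdd: "bdd_above A"
    by (rule bdd_aboveI[of _ 1]) (auto simp: A_def)
  have above: "a \<le> g" if "a \<in> A" for a
    using that bdd g by (auto intro: cSup_upper)
  have least: "g \<le> c" if "\<And>a. a \<in> A \<Longrightarrow> a \<le> c" "0 \<le> c" for c
    using that g by (auto intro: cSup_least)
  have g1: "g \<le> 1"
    by (rule least) (auto simp: A_def)
  have g0: "0 \<le> g"
  proof (cases "A = {}")
    case False
    then obtain a where "a \<in> A" by blast
    then show ?thesis using above[of a] by (auto simp: A_def)
  qed (simp add: g)
  then show "pseudo_inverse f y \<in> {0..1}"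
    using g1 by (simp add: g_def)
  have attained: "y \<le> f g"
  proof (cases "g = 1")
    case False
    then have "g \<in> {0..<1}" using g0 g1 by simp
    then have "(f \<longlongrightarrow> f g) (at_right g)"
      using rc by (simp add: right_continuous_unit_def continuous_within)
    moreover have "eventually (\<lambda>t. y \<le> f t) (at_right g)"
      unfolding eventually_at_right_field
    proof (intro exI[of _ 1] conjI allI impI)
      show "g < 1" using g1 False by simp
      fix t assume t: "g < t" "t < 1"
      then have "t \<notin> A" using above by force
      then show "y \<le> f t" using t g0 by (auto simp: A_def)
    qed
    ultimately show ?thesis
      by (intro tendsto_lowerbound[of f "f g" "at_right g"]) auto
  qed (use y in simp)
  show "pseudo_inverse f y \<le> x \<longleftrightarrow> y \<le> f x"
    unfolding g_def[symmetric]
  proof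
    assume "g \<le> x"
    then have "f g \<le> f x" using mono x g0 g1 by (auto simp: mono_on_def)
    then show "y \<le> f x" using attained by simp
  next
    assume *: "y \<le> f x"
    show "g \<le> x"
    proof (rule least)
      fix a assume a: "a \<in> A"
      show "a \<le> x"
      proof (rule ccontr)
        assume "\<not> a \<le> x"
        then have "f x \<le> f a" using mono x a by (auto simp: mono_on_def A_def)
        then show False using a * by (auto simp: A_def)
      qed
    qed (use x in simp)
  qed
qed

lemma pseudo_inverse_eq_iff:
  fixes f :: "real \<Rightarrow> real"
  assumes "mono_on {0..1} f" and "right_continuous_unit f"
    and u: "u \<le> f 1" and v: "v \<le> f 1"
  shows "pseudo_inverse f u = pseudo_inverse f v \<longleftrightarrow>
    {min u v..<max u v} \<inter> f ` {0..1} = {}"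
proof -
  note galois = pseudo_inverse_le_iff[OF assms(1,2)]
  have in_unit: "pseudo_inverse f u \<in> {0..1}" "pseudo_inverse f v \<in> {0..1}"
    using galois(1)[OF u, of 0] galois(1)[OF v, of 0] by auto
  (* A value of an adjoint is determined by its upper bounds. *)
  have "pseudo_inverse f u = pseudo_inverse f v \<longleftrightarrow>
      (\<forall>x\<in>{0..1}. pseudo_inverse f u \<le> x \<longleftrightarrow> pseudo_inverse f v \<le> x)"
    using in_unit by (metis order.antisym order.refl)
  also have "\<dots> \<longleftrightarrow> (\<forall>x\<in>{0..1}. u \<le> f x \<longleftrightarrow> v \<le> f x)"
    using galois(2)[OF u] galois(2)[OF v] by simp
  also have "\<dots> \<longleftrightarrow> {min u v..<max u v} \<inter> f ` {0..1} = {}"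
    by (auto simp: min_def max_def disjoint_iff not_le split: if_splits)
  finally show ?thesis .
qed

lemma f_pseudo_inverse_f:
  fixes f :: "real \<Rightarrow> real"
  assumes mono: "mono_on {0..1} f" and rc: "right_continuous_unit f"
    and m: "m \<in> f ` {0..1}"
  shows "f (pseudo_inverse f m) = m"
proof -
  obtain x where x: "x \<in> {0..1}" "m = f x" using m by blast
  then have m1: "m \<le> f 1" using mono by (auto simp: mono_on_def)
  note galois = pseudo_inverse_le_iff[OF mono rc m1]
  have g: "pseudo_inverse f m \<in> {0..1}" using galois(1) x by blast
  have "pseudo_inverse f m \<le> x" using galois(2) x by simp
  then have "f (pseudo_inverse f m) \<le> m" using mono x g by (auto simp: mono_on_def)
  moreover have "m \<le> f (pseudo_inverse f m)" using galois(2)[OF g] by simp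
  ultimately show ?thesis by simp
qed

section \<open>The gaps of an associated pair\<close>

text \<open>In the gapless case every interval is the point \<open>{Sup M}\<close>, whose gap is empty.\<close>

lemma associated_gapless:
  assumes "associated M K b d C" and M: "M = {0..Sup M}" and k: "k \<in> K"
  shows "b k = Sup M" and "d k = Sup M"
proof -
  have "(\<lambda>k. {b k..d k}) ` K = {{Sup M..Sup M}}"
    using assms(1) M unfolding associated_def Let_def by presburger
  then have "{b k..d k} = {Sup M..Sup M}" using k by blast
  then show "b k = Sup M" and "d k = Sup M"
    unfolding Icc_eq_Icc by simp_all
qed

lemma associated_gap_proper:
  assumes "associated M K b d C" and "k \<in> K" and u: "u \<in> gap M b d k"
  shows "M \<noteq> {0..Sup M}"
proof
  assume "M = {0..Sup M}"
  then have "b k = d k" using associated_gapless[OF assms(1) _ assms(2)] by simp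
  then show False using u by (auto simp: gap_def split: if_splits)
qed

lemma associated_gap_unit:
  assumes "associated M K b d C" and "k \<in> K" and "u \<in> gap M b d k"
  shows "u \<in> {0..1}"
proof -
  have "0 \<le> b k \<and> d k \<le> 1"
    using assms(1,2) associated_gap_proper[OF assms]
    unfolding associated_def Let_def by simp
  then show ?thesis using assms(3) by (auto simp: gap_def split: if_splits)
qed

lemma associated_right_end:
  assumes "associated M K b d C" and "k \<in> K"
  shows "d k \<in> M"
proof (cases "M = {0..Sup M}")
  case True
  then have "d k = Sup M"
    by (rule associated_gapless(2)[OF assms(1) _ assms(2)])
  moreover have "M \<noteq> {}"
    using assms(1) by (auto simp: associated_def range_family_def)
  ultimately show ?thesis using True by (metis atLeastatMost_empty_iff2 atLeastAtMost_iff order.refl)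
next
  case False
  then have "{b k..d k} \<inter> C = {d k} \<or> {b k..d k} \<inter> C = {b k, d k}"
    and M: "M = C \<union> ({0..Sup M} - \<Union>((\<lambda>k. {b k..d k}) ` K))"
    using assms unfolding associated_def Let_def by simp_all
  then have "d k \<in> C" by blast
  then show ?thesis using M by blast
qed

text \<open>
  Together with \<open>associated_gap_cover\<close>: the gaps make up exactly \<open>[0, max M] - M\<close>, and rounding up a
  point of gap \<open>k\<close> into \<open>M\<close> gives \<open>d\<^sub>k\<close>. Only \<open>b\<^sub>k\<close> could be a second point of \<open>M\<close> in \<open>[b\<^sub>k, d\<^sub>k]\<close>, and
  the gap leaves it out when it is one.
\<close>

lemma associated_gap_free:
  assumes "associated M K b d C" and k: "k \<in> K" and u: "u \<in> gap M b d k"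
  shows "u < d k" and "{u..<d k} \<inter> M = {}"
proof -
  show "u < d k" using u by (auto simp: gap_def split: if_splits)
  have bu: "b k \<le> u" and b: "u = b k \<Longrightarrow> b k \<notin> M"
    using u by (auto simp: gap_def split: if_splits)
  have "M \<noteq> {0..Sup M}" by (rule associated_gap_proper[OF assms])
  then have "{b k..d k} \<inter> C = {d k} \<or> {b k..d k} \<inter> C = {b k, d k}"
    and M: "M = C \<union> ({0..Sup M} - \<Union>((\<lambda>k. {b k..d k}) ` K))"
    using assms(1) k unfolding associated_def Let_def by simp_all
  then have C: "{b k..d k} \<inter> C \<subseteq> {b k, d k}" by blast
  show "{u..<d k} \<inter> M = {}"
  proof (rule equals0I)
    fix m assume m: "m \<in> {u..<d k} \<inter> M"
    then have mk: "m \<in> {b k..d k}" using bu by simp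
    then have "m \<in> C" using M m k by blast
    then have "m \<in> {b k, d k}" using C mk by blast
    then have "m = b k" using m by auto
    then show False using m bu b by auto
  qed
qed

lemma associated_gap_cover:
  assumes "associated M K b d C" and u: "u \<in> {0..Sup M} - M"
  shows "\<exists>k\<in>K. u \<in> gap M b d k"
proof -
  have "M \<noteq> {0..Sup M}" using u by blast
  then have M: "M = C \<union> ({0..Sup M} - \<Union>((\<lambda>k. {b k..d k}) ` K))"
    using assms(1) unfolding associated_def Let_def by simp
  then obtain k where k: "k \<in> K" "u \<in> {b k..d k}" using u by blast
  have "d k \<in> M" using associated_right_end[OF assms(1) k(1)] .
  then have "u < d k" using k u by (cases "u = d k") auto
  moreover have "b k < u" if "b k \<in> M" using k u that by (cases "u = b k") auto
  ultimately show ?thesis using k by (auto simp: gap_def)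
qed

section \<open>Rounding up and the three obstruction sets\<close>

text \<open>
  What the pseudo-inverse \<open>g\<close> and the rounding \<open>r\<close> into \<open>M\<close> have to satisfy for the comparison with
  \<open>\<TT>(M)\<close>. Keeping \<open>g\<close> abstract leaves only the case distinction on gaps.
\<close>

locale gap_rounding =
  fixes Ts :: "real \<Rightarrow> real \<Rightarrow> real" and M :: "real set" and K :: "'k set"
    and b d :: "'k \<Rightarrow> real" and g r :: "real \<Rightarrow> real"
  assumes closed: "binop_unit Ts" and assoc: "associative_unit Ts"
    and M_unit: "M \<subseteq> {0..1}"
    and g_eq_iff: "\<And>u v. u \<in> {0..1} \<Longrightarrow> v \<in> {0..1} \<Longrightarrow>
      g u = g v \<longleftrightarrow> {min u v..<max u v} \<inter> M = {}"
    and r_in: "\<And>u. u \<in> M \<Longrightarrow> r u = u"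
    and r_gap: "\<And>k u. k \<in> K \<Longrightarrow> u \<in> gap M b d k \<Longrightarrow> r u = d k"
    and d_in: "\<And>k. k \<in> K \<Longrightarrow> d k \<in> M"
    and gap_out: "\<And>k u. k \<in> K \<Longrightarrow> u \<in> gap M b d k \<Longrightarrow> u \<notin> M"
    and gap_cover: "\<And>u. u \<in> {0..1} - M \<Longrightarrow> \<exists>k\<in>K. u \<in> gap M b d k"
begin

abbreviation assoc_at :: "real \<Rightarrow> real \<Rightarrow> real \<Rightarrow> bool" where
  "assoc_at x y z \<equiv> g (Ts (r (Ts x y)) z) = g (Ts x (r (Ts y z)))"

lemma unitI [intro]: "x \<in> M \<Longrightarrow> x \<in> {0..1}"
  using M_unit by blast

lemma Ts_unit [intro]: "x \<in> {0..1} \<Longrightarrow> y \<in> {0..1} \<Longrightarrow> Ts x y \<in> {0..1}"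
  using closed unfolding binop_unit_def by blast

lemma Ts_assoc:
  "x \<in> {0..1} \<Longrightarrow> y \<in> {0..1} \<Longrightarrow> z \<in> {0..1} \<Longrightarrow> Ts (Ts x y) z = Ts x (Ts y z)"
  using assoc unfolding associative_unit_def by blast

lemma Ts_notin_iff:
  assumes "x \<in> M" "y \<in> M"
  shows "Ts x y \<notin> M \<longleftrightarrow> (\<exists>k\<in>K. Ts x y \<in> gap M b d k)"
  using gap_out gap_cover[of "Ts x y"] Ts_unit[OF unitI[OF assms(1)] unitI[OF assms(2)]]
  by blast

lemma O_set_disjoint_iff:
  assumes "A \<subseteq> {0..1}"
  shows "O_set A \<inter> M = {} \<longleftrightarrow> (\<forall>u\<in>A. \<forall>v\<in>A. g u = g v)"
proof -
  have "O_set A \<inter> M = {} \<longleftrightarrow> (\<forall>u\<in>A. \<forall>v\<in>A. {min u v..<max u v} \<inter> M = {})"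
    unfolding O_set_def by blast
  also have "\<dots> \<longleftrightarrow> (\<forall>u\<in>A. \<forall>v\<in>A. g u = g v)"
    using assms by (intro ball_cong refl g_eq_iff[symmetric]) blast+
  finally show ?thesis .
qed

lemma O_set_insert_disjoint_iff:
  assumes "insert a (h ` X) \<subseteq> {0..1}"
  shows "O_set (insert a (h ` X)) \<inter> M = {} \<longleftrightarrow> (\<forall>x\<in>X. g (h x) = g a)"
  unfolding O_set_disjoint_iff[OF assms] by auto

lemma assoc_at_in:
  assumes "x \<in> M" "y \<in> M" "z \<in> M" and "Ts x y \<in> M" "Ts y z \<in> M"
  shows "assoc_at x y z"
  using assms Ts_assoc[OF unitI unitI unitI] by (simp add: r_in)

text \<open>
  Constancy of \<open>g\<close> on \<open>T\<^sup>*(I\<^sub>k\<^sup>y, t)\<close> may be tested against the value at \<open>d\<^sub>k\<close>, the common rounding of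
  all \<open>T\<^sup>* x y\<close> in the gap; the other value \<open>T\<^sup>* (T\<^sup>* x y) t\<close> is re-associated.
\<close>

lemma T1_disjoint_iff:
  "T1_set Ts M K b d \<inter> M = {} \<longleftrightarrow>
   (\<forall>x\<in>M. \<forall>y\<in>M. \<forall>z\<in>M. Ts x y \<notin> M \<longrightarrow> Ts y z \<in> M \<longrightarrow> assoc_at x y z)"
proof -
  have at: "O_set ((\<lambda>x. Ts x t) ` I_up Ts M b d k y) \<inter> M = {} \<longleftrightarrow>
      (\<forall>x\<in>M. Ts x y \<in> gap M b d k \<longrightarrow> assoc_at x y t)"
    if y: "y \<in> M" and k: "k \<in> K" and t: "t \<in> M" "Ts y t \<in> M" for y k t
  proof -
    have I: "(\<lambda>x. Ts x t) ` I_up Ts M b d k y =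
        insert (Ts (d k) t) ((\<lambda>x. Ts (Ts x y) t) ` M_up_k Ts M b d k y)"
      by (simp add: I_up_def image_image)
    have "insert (Ts (d k) t) ((\<lambda>x. Ts (Ts x y) t) ` M_up_k Ts M b d k y) \<subseteq> {0..1}"
      using y t d_in[OF k] by (auto simp: M_up_k_def simp del: atLeastAtMost_iff)
    then have "O_set ((\<lambda>x. Ts x t) ` I_up Ts M b d k y) \<inter> M = {} \<longleftrightarrow>
        (\<forall>x\<in>M_up_k Ts M b d k y. g (Ts (Ts x y) t) = g (Ts (d k) t))"
      unfolding I by (rule O_set_insert_disjoint_iff)
    also have "\<dots> \<longleftrightarrow> (\<forall>x\<in>M. Ts x y \<in> gap M b d k \<longrightarrow> assoc_at x y t)"
      using y t k by (auto simp: M_up_k_def r_in r_gap Ts_assoc unitI simp del: atLeastAtMost_iff)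
    finally show ?thesis .
  qed
  have "T1_set Ts M K b d \<inter> M = {} \<longleftrightarrow> (\<forall>y\<in>M. \<forall>k\<in>K. \<forall>t\<in>M. Ts y t \<in> M \<longrightarrow>
      O_set ((\<lambda>x. Ts x t) ` I_up Ts M b d k y) \<inter> M = {})"
    unfolding T1_set_def M_low_def by blast
  also have "\<dots> \<longleftrightarrow> (\<forall>y\<in>M. \<forall>k\<in>K. \<forall>t\<in>M. Ts y t \<in> M \<longrightarrow>
      (\<forall>x\<in>M. Ts x y \<in> gap M b d k \<longrightarrow> assoc_at x y t))"
    by (intro ball_cong imp_cong refl at)
  also have "\<dots> \<longleftrightarrow> (\<forall>x\<in>M. \<forall>y\<in>M. \<forall>z\<in>M. Ts x y \<notin> M \<longrightarrow> Ts y z \<in> M \<longrightarrow> assoc_at x y z)"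
    by (meson Ts_notin_iff)
  finally show ?thesis .
qed

lemma T2_disjoint_iff:
  "T2_set Ts M K b d \<inter> M = {} \<longleftrightarrow>
   (\<forall>x\<in>M. \<forall>y\<in>M. \<forall>z\<in>M. Ts x y \<in> M \<longrightarrow> Ts y z \<notin> M \<longrightarrow> assoc_at x y z)"
proof -
  have at: "O_set ((\<lambda>x. Ts t x) ` I_low Ts M b d k y) \<inter> M = {} \<longleftrightarrow>
      (\<forall>z\<in>M. Ts y z \<in> gap M b d k \<longrightarrow> assoc_at t y z)"
    if y: "y \<in> M" and k: "k \<in> K" and t: "t \<in> M" "Ts t y \<in> M" for y k t
  proof -
    have I: "(\<lambda>x. Ts t x) ` I_low Ts M b d k y =
        insert (Ts t (d k)) ((\<lambda>x. Ts t (Ts y x)) ` M_low_k Ts M b d k y)"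
      by (simp add: I_low_def image_image)
    have "insert (Ts t (d k)) ((\<lambda>x. Ts t (Ts y x)) ` M_low_k Ts M b d k y) \<subseteq> {0..1}"
      using y t d_in[OF k] by (auto simp: M_low_k_def simp del: atLeastAtMost_iff)
    then have "O_set ((\<lambda>x. Ts t x) ` I_low Ts M b d k y) \<inter> M = {} \<longleftrightarrow>
        (\<forall>z\<in>M_low_k Ts M b d k y. g (Ts t (Ts y z)) = g (Ts t (d k)))"
      unfolding I by (rule O_set_insert_disjoint_iff)
    also have "\<dots> \<longleftrightarrow> (\<forall>z\<in>M. Ts y z \<in> gap M b d k \<longrightarrow> assoc_at t y z)"
      using y t k by (auto simp: M_low_k_def r_in r_gap Ts_assoc unitI simp del: atLeastAtMost_iff)
    finally show ?thesis .
  qed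
  have "T2_set Ts M K b d \<inter> M = {} \<longleftrightarrow> (\<forall>y\<in>M. \<forall>k\<in>K. \<forall>t\<in>M. Ts t y \<in> M \<longrightarrow>
      O_set ((\<lambda>x. Ts t x) ` I_low Ts M b d k y) \<inter> M = {})"
    unfolding T2_set_def M_up_def by blast
  also have "\<dots> \<longleftrightarrow> (\<forall>y\<in>M. \<forall>k\<in>K. \<forall>t\<in>M. Ts t y \<in> M \<longrightarrow>
      (\<forall>z\<in>M. Ts y z \<in> gap M b d k \<longrightarrow> assoc_at t y z))"
    by (intro ball_cong imp_cong refl at)
  also have "\<dots> \<longleftrightarrow> (\<forall>x\<in>M. \<forall>y\<in>M. \<forall>z\<in>M. Ts x y \<in> M \<longrightarrow> Ts y z \<notin> M \<longrightarrow> assoc_at x y z)"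
    using Ts_notin_iff by blast
  finally show ?thesis .
qed

text \<open>
  Associativity only equates values \<open>T\<^sup>* x d\<^sub>l\<close> with values \<open>T\<^sup>* d\<^sub>k z\<close>. Once both families are
  non-empty, equality across them forces equality within each; this is why \<open>J\<^sub>k\<^sub>l\<^sup>y\<close> is set to \<open>\<emptyset>\<close>
  when one of the families is empty.
\<close>

lemma T3_disjoint_iff:
  "T3_set Ts M K b d \<inter> M = {} \<longleftrightarrow>
   (\<forall>x\<in>M. \<forall>y\<in>M. \<forall>z\<in>M. Ts x y \<notin> M \<longrightarrow> Ts y z \<notin> M \<longrightarrow> assoc_at x y z)"
proof -
  have at: "J_set Ts M b d k l y \<inter> M = {} \<longleftrightarrow>
      (\<forall>x\<in>M. \<forall>z\<in>M. Ts x y \<in> gap M b d k \<longrightarrow> Ts y z \<in> gap M b d l \<longrightarrow> assoc_at x y z)"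
    if y: "y \<in> M" and k: "k \<in> K" and l: "l \<in> K" for y k l
  proof -
    let ?U = "M_up_k Ts M b d k y" and ?L = "M_low_k Ts M b d l y"
    have sub: "(\<lambda>x. Ts x (d l)) ` ?U \<union> (\<lambda>x. Ts (d k) x) ` ?L \<subseteq> {0..1}"
      using y d_in[OF k] d_in[OF l]
      by (auto simp: M_up_k_def M_low_k_def simp del: atLeastAtMost_iff)
    have across: "(\<forall>u\<in>A \<union> B. \<forall>v\<in>A \<union> B. g u = g v) \<longleftrightarrow> (\<forall>u\<in>A. \<forall>v\<in>B. g v = g u)"
      if "A \<noteq> {}" "B \<noteq> {}" for A B
      using that by (metis Un_iff equals0I)
    have "J_set Ts M b d k l y \<inter> M = {} \<longleftrightarrow>
        (\<forall>x\<in>?U. \<forall>z\<in>?L. g (Ts (d k) z) = g (Ts x (d l)))"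
    proof (cases "?U = {} \<or> ?L = {}")
      case False
      then show ?thesis
        unfolding J_set_def by (simp add: O_set_disjoint_iff[OF sub] across)
    qed (auto simp: J_set_def)
    also have "\<dots> \<longleftrightarrow>
        (\<forall>x\<in>M. \<forall>z\<in>M. Ts x y \<in> gap M b d k \<longrightarrow> Ts y z \<in> gap M b d l \<longrightarrow> assoc_at x y z)"
      using k l by (auto simp: M_up_k_def M_low_k_def r_gap)
    finally show ?thesis .
  qed
  have "T3_set Ts M K b d \<inter> M = {} \<longleftrightarrow>
      (\<forall>y\<in>M. \<forall>k\<in>K. \<forall>l\<in>K. J_set Ts M b d k l y \<inter> M = {})"
    unfolding T3_set_def by blast
  also have "\<dots> \<longleftrightarrow> (\<forall>y\<in>M. \<forall>k\<in>K. \<forall>l\<in>K. \<forall>x\<in>M. \<forall>z\<in>M.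
      Ts x y \<in> gap M b d k \<longrightarrow> Ts y z \<in> gap M b d l \<longrightarrow> assoc_at x y z)"
    by (intro ball_cong refl at)
  also have "\<dots> \<longleftrightarrow> (\<forall>x\<in>M. \<forall>y\<in>M. \<forall>z\<in>M. Ts x y \<notin> M \<longrightarrow> Ts y z \<notin> M \<longrightarrow> assoc_at x y z)"
    using Ts_notin_iff by blast
  finally show ?thesis .
qed

lemma T_set_disjoint_iff:
  "T_set Ts M K b d \<inter> M = {} \<longleftrightarrow> (\<forall>x\<in>M. \<forall>y\<in>M. \<forall>z\<in>M. assoc_at x y z)"
proof -
  have "T_set Ts M K b d \<inter> M = {} \<longleftrightarrow> T1_set Ts M K b d \<inter> M = {} \<and>
      T2_set Ts M K b d \<inter> M = {} \<and> T3_set Ts M K b d \<inter> M = {}"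
    unfolding T_set_def by blast
  then show ?thesis
    unfolding T1_disjoint_iff T2_disjoint_iff T3_disjoint_iff using assoc_at_in by blast
qed

end

section \<open>Associativity of the generated function\<close>

theorem corollary5p2:
  fixes Ts T :: "real \<Rightarrow> real \<Rightarrow> real" and f :: "real \<Rightarrow> real"
    and M C :: "real set" and K :: "'k set" and b d :: "'k \<Rightarrow> real"
  assumes "binop_unit Ts" and "associative_unit Ts" and "monotone_unit Ts"
    and "\<exists>e. neutral_unit Ts e"
    and "f \<in> {0..1} \<rightarrow> {0..1}" and "\<not> f constant_on {0..1}" and "mono_on {0..1} f"
    and "right_continuous_unit f" and "f 1 = 1"
    and "M = f ` {0..1}"
    and "associated M K b d C"
    and "\<forall>x\<in>{0..1}. \<forall>y\<in>{0..1}. T x y = pseudo_inverse f (Ts (f x) (f y))"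
  shows "associative_unit T \<longleftrightarrow> T_set Ts M K b d \<inter> M = {}"
proof -
  note closed = assms(1) and f_unit = assms(5) and mono = assms(7) and rc = assms(8)
    and f1 = assms(9) and M = assms(10) and pair = assms(11) and T = assms(12)
  let ?g = "pseudo_inverse f"
  have M_unit: "M \<subseteq> {0..1}" using f_unit M by auto
  have "1 \<in> M" using M f1 by force
  then have SupM: "Sup M = 1" using M_unit by (intro cSup_eq_maximum) auto
  have eq_iff: "?g u = ?g v \<longleftrightarrow> {min u v..<max u v} \<inter> M = {}"
    if "u \<in> {0..1}" "v \<in> {0..1}" for u v
    using pseudo_inverse_eq_iff[OF mono rc, of u v] that f1 M by simp
  have round_in: "f (?g u) = u" if "u \<in> M" for u
    using f_pseudo_inverse_f[OF mono rc] that M by blast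
  interpret gap_rounding Ts M K b d ?g "\<lambda>u. f (?g u)"
  proof
    show "f (?g u) = d k" if "k \<in> K" "u \<in> gap M b d k" for k u
    proof -
      have d: "d k \<in> M" by (rule associated_right_end[OF pair that(1)])
      have "?g u = ?g (d k)"
        using associated_gap_free[OF pair that] eq_iff[of u "d k"] associated_gap_unit[OF pair that] d M_unit
        by auto
      then show ?thesis using round_in[OF d] by simp
    qed
    show "u \<notin> M" if "k \<in> K" "u \<in> gap M b d k" for k u
      using associated_gap_free[OF pair that] by auto
    show "\<exists>k\<in>K. u \<in> gap M b d k" if "u \<in> {0..1} - M" for u
      using associated_gap_cover[OF pair] that SupM by simp
  qed (fact closed assms(2) M_unit eq_iff round_in associated_right_end[OF pair])+
  have g_unit: "?g u \<in> {0..1}" if "u \<in> {0..1}" for u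
    using pseudo_inverse_le_iff(1)[OF mono rc, of u 0] that f1 by simp
  have T_unit: "T x y \<in> {0..1}" if "x \<in> {0..1}" "y \<in> {0..1}" for x y
  proof -
    have "f x \<in> {0..1}" "f y \<in> {0..1}" using f_unit that by blast+
    then show ?thesis using T that g_unit[OF Ts_unit] by simp
  qed
  have "associative_unit T \<longleftrightarrow>
      (\<forall>x\<in>{0..1}. \<forall>y\<in>{0..1}. \<forall>z\<in>{0..1}. assoc_at (f x) (f y) (f z))"
    unfolding associative_unit_def
  proof (intro ball_cong refl)
    fix x y z :: real
    assume xyz: "x \<in> {0..1}" "y \<in> {0..1}" "z \<in> {0..1}"
    have "T (T x y) z = ?g (Ts (f (?g (Ts (f x) (f y)))) (f z))"
      using T xyz T_unit[OF xyz(1,2)] by metis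
    moreover have "T x (T y z) = ?g (Ts (f x) (f (?g (Ts (f y) (f z)))))"
      using T xyz T_unit[OF xyz(2,3)] by metis
    ultimately show "T (T x y) z = T x (T y z) \<longleftrightarrow> assoc_at (f x) (f y) (f z)"
      by simp
  qed
  also have "\<dots> \<longleftrightarrow> (\<forall>x\<in>M. \<forall>y\<in>M. \<forall>z\<in>M. assoc_at x y z)"
    unfolding M by blast
  finally show ?thesis
    unfolding T_set_disjoint_iff .
qed

end
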